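(* Let $(G,P,\theta)$ be an algebraic dynamical system and $S=G\rtimes_\theta P$. Then $S$ has property (AR) provided that (1) $P$ is directed with respect to $\leq$, or (2) incomparable elements in $P$ have disjoint principal right ideals. In particular, $S$ has property (AR) if $P$ satisfies one of the following conditions: (3) $P$ is a group; (4) $P$ is abelian; (5) $P$ is isomorphic to the free monoid $\mathbb{F}_n^+$ on $n$ generators for some $1\leq n<\infty$; (6) $P$ is given by the Zappa-Szép product $X^*\bowtie H$ for a self-similar action $(H,X)$.
   Context: All semigroups are countable, discrete and left cancellative. A semigroup is right LCM if the intersection of two principal right ideals is either empty or again a principal right ideal. An algebraic dynamical system $(G,P,\theta)$ is an action $\theta$ of a right LCM semigroup $P$ with identity by injective endomorphisms of a group $G$ (so $\theta_p\theta_q=\theta_{pq}$, $\theta_1=\mathrm{id}$) such that $pP\cap qP=rP$ implies $\theta_p(G)\cap\theta_q(G)=\theta_r(G)$ for all $p,q,r\in P$. $G\rtimes_\theta P$ is the set $G\times P$ with product $(g,p)(h,q)=(g\theta_p(h),pq)$; it is a right LCM semigroup with identity. For $p,q\in P$ write $p\geq q$ (or $q\leq p$) if $p\in qP$. Elements are comparable if $p\leq q$ or $q\leq p$, and incomparable otherwise. $P$ is directed with respect to $\leq$ if $pP\cap qP\neq\emptyset$ for all $p,q\in P$. A finite subset $F\subset S$ is a foundation set for $S$ if for every $s\in S$ there is $t\in F$ with $sS\cap tS\neq\emptyset$. A foundation set $F$ is accurate if $sS\cap tS=\emptyset$ for all distinct $s,t\in F$. $S$ has the accurate refinement property, property (AR),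 if for every foundation set $F$ there is an accurate foundation set $F_a$ such that every $f_a\in F_a$ lies in $fS$ for some $f\in F$. A self-similar action $(H,X)$ consists of a group $H$, a finite alphabet $X$ and a faithful action of $H$ on the set $X^*$ of finite words (the free monoid on $X$) such that for all $h\in H$, $x\in X$ there is a unique $h|_x\in H$ with $h\cdot(xw)=(h\cdot x)(h|_x\cdot w)$ for all $w\in X^*$ (with $h\cdot x\in X$); restrictions extend to words by $h|_{vw}=(h|_v)|_w$ and $h|_{\varnothing}=h$. The monoid $X^*\bowtie H$ is the set $X^*\times H$ with product $(v,h)(w,k)=(v(h\cdot w),\,h|_w k)$. *)

theory Defs
  imports "HOL-Algebra.Group_Action" "HOL-Library.Countable_Set"
begin

section \<open>Right LCM monoids\<close>

text \<open>
  Every semigroup below has an identity, so the principal right ideal generated by \<open>p\<close> is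
  \<open>pP = {p \<otimes> x | x. x \<in> P}\<close>.
\<close>

abbreviation principal_right_ideal :: "('a, 'm) monoid_scheme \<Rightarrow> 'a \<Rightarrow> 'a set" where
  "principal_right_ideal P p \<equiv> p <#\<^bsub>P\<^esub> carrier P"

locale right_lcm_monoid = monoid P for P (structure) +
  assumes countable_carrier: "countable (carrier P)"
    and left_cancel:
      "\<lbrakk>p \<in> carrier P; q \<in> carrier P; r \<in> carrier P; p \<otimes> q = p \<otimes> r\<rbrakk> \<Longrightarrow> q = r"
    and right_lcm:
      "\<lbrakk>p \<in> carrier P; q \<in> carrier P\<rbrakk> \<Longrightarrow>
        principal_right_ideal P p \<inter> principal_right_ideal P q = {} \<or>
        (\<exists>r\<in>carrier P.
          principal_right_ideal P p \<inter> principal_right_ideal P q = principal_right_ideal P r)"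

text \<open>\<open>rdiv_le P q p\<close> renders \<open>q \<le> p\<close>, that is \<open>p \<in> qP\<close>.\<close>

definition rdiv_le :: "('a, 'm) monoid_scheme \<Rightarrow> 'a \<Rightarrow> 'a \<Rightarrow> bool" where
  "rdiv_le P q p \<longleftrightarrow> p \<in> principal_right_ideal P q"

definition comparable :: "('a, 'm) monoid_scheme \<Rightarrow> 'a \<Rightarrow> 'a \<Rightarrow> bool" where
  "comparable P p q \<longleftrightarrow> rdiv_le P p q \<or> rdiv_le P q p"

definition directed_monoid :: "('a, 'm) monoid_scheme \<Rightarrow> bool" where
  "directed_monoid P \<longleftrightarrow>
    (\<forall>p\<in>carrier P. \<forall>q\<in>carrier P.
      principal_right_ideal P p \<inter> principal_right_ideal P q \<noteq> {})"

definition incomparable_disjoint :: "('a, 'm) monoid_scheme \<Rightarrow> bool" where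
  "incomparable_disjoint P \<longleftrightarrow>
    (\<forall>p\<in>carrier P. \<forall>q\<in>carrier P. \<not> comparable P p q \<longrightarrow>
      principal_right_ideal P p \<inter> principal_right_ideal P q = {})"


section \<open>Foundation sets and accurate refinement\<close>

definition foundation_set :: "('a, 'm) monoid_scheme \<Rightarrow> 'a set \<Rightarrow> bool" where
  "foundation_set S F \<longleftrightarrow>
    finite F \<and> F \<subseteq> carrier S \<and>
    (\<forall>s\<in>carrier S. \<exists>t\<in>F. principal_right_ideal S s \<inter> principal_right_ideal S t \<noteq> {})"

definition accurate_foundation_set :: "('a, 'm) monoid_scheme \<Rightarrow> 'a set \<Rightarrow> bool" where
  "accurate_foundation_set S F \<longleftrightarrow>
    foundation_set S F \<and>
    (\<forall>s\<in>F. \<forall>t\<in>F. s \<noteq> t \<longrightarrow> principal_right_ideal S s \<inter> principal_right_ideal S t = {})"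

definition accurate_refinement_property :: "('a, 'm) monoid_scheme \<Rightarrow> bool" where
  "accurate_refinement_property S \<longleftrightarrow>
    (\<forall>F. foundation_set S F \<longrightarrow>
      (\<exists>F\<^sub>a. accurate_foundation_set S F\<^sub>a \<and>
        (\<forall>f\<^sub>a\<in>F\<^sub>a. \<exists>f\<in>F. f\<^sub>a \<in> principal_right_ideal S f)))"


section \<open>Algebraic dynamical systems\<close>

text \<open>
  The group is required to be countable because all semigroups, in particular \<open>G \<rtimes>\<^sub>\<theta> P\<close>, are.
  The equations between endomorphisms are required on the carrier of \<open>G\<close> only.
\<close>

locale algebraic_dynamical_system =
  G: group G + P: right_lcm_monoid P
  for G :: "('g, 'm) monoid_scheme" and P :: "('p, 'n) monoid_scheme" +
  fixes \<theta> :: "'p \<Rightarrow> 'g \<Rightarrow> 'g"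
  assumes countable_group: "countable (carrier G)"
    and endo: "p \<in> carrier P \<Longrightarrow> \<theta> p \<in> hom G G"
    and inj: "p \<in> carrier P \<Longrightarrow> inj_on (\<theta> p) (carrier G)"
    and action_mult:
      "\<lbrakk>p \<in> carrier P; q \<in> carrier P; g \<in> carrier G\<rbrakk> \<Longrightarrow> \<theta> p (\<theta> q g) = \<theta> (p \<otimes>\<^bsub>P\<^esub> q) g"
    and action_one: "g \<in> carrier G \<Longrightarrow> \<theta> \<one>\<^bsub>P\<^esub> g = g"
    and preserves_order:
      "\<lbrakk>p \<in> carrier P; q \<in> carrier P; r \<in> carrier P;
        principal_right_ideal P p \<inter> principal_right_ideal P q = principal_right_ideal P r\<rbrakk> \<Longrightarrow>
        \<theta> p ` carrier G \<inter> \<theta> q ` carrier G = \<theta> r ` carrier G"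

definition semidirect_product ::
  "('g, 'm) monoid_scheme \<Rightarrow> ('p, 'n) monoid_scheme \<Rightarrow> ('p \<Rightarrow> 'g \<Rightarrow> 'g) \<Rightarrow> ('g \<times> 'p) monoid" where
  "semidirect_product G P \<theta> =
    \<lparr>carrier = carrier G \<times> carrier P,
     monoid.mult = (\<lambda>(g, p) (h, q). (g \<otimes>\<^bsub>G\<^esub> \<theta> p h, p \<otimes>\<^bsub>P\<^esub> q)),
     one = (\<one>\<^bsub>G\<^esub>, \<one>\<^bsub>P\<^esub>)\<rparr>"


section \<open>Free monoids and self-similar actions\<close>

definition free_monoid :: "'x set \<Rightarrow> 'x list monoid" where
  "free_monoid A = \<lparr>carrier = lists A, monoid.mult = (@), one = []\<rparr>"

text \<open>
  An action of \<open>H\<close> on \<open>A\<^sup>*\<close> is a homomorphism into the group of all bijections of the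
  set \<open>A\<^sup>*\<close>; letters are identified with words of length one.
\<close>

locale self_similar_action = faithful_action H "lists A" \<phi>
  for H :: "('h, 'm) monoid_scheme" and A :: "'x set" and \<phi> :: "'h \<Rightarrow> 'x list \<Rightarrow> 'x list" +
  assumes finite_alphabet: "finite A"
    and letter: "\<lbrakk>h \<in> carrier H; x \<in> A\<rbrakk> \<Longrightarrow> \<exists>y\<in>A. \<phi> h [x] = [y]"
    and self_similar:
      "\<lbrakk>h \<in> carrier H; x \<in> A\<rbrakk> \<Longrightarrow>
        \<exists>!k. k \<in> carrier H \<and> (\<forall>w\<in>lists A. \<phi> h (x # w) = \<phi> h [x] @ \<phi> k w)"

definition restr ::
  "('h, 'm) monoid_scheme \<Rightarrow> 'x set \<Rightarrow> ('h \<Rightarrow> 'x list \<Rightarrow> 'x list) \<Rightarrow> 'h \<Rightarrow> 'x \<Rightarrow> 'h" where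
  "restr H A \<phi> h x =
    (THE k. k \<in> carrier H \<and> (\<forall>w\<in>lists A. \<phi> h (x # w) = \<phi> h [x] @ \<phi> k w))"

primrec restr_word ::
  "('h, 'm) monoid_scheme \<Rightarrow> 'x set \<Rightarrow> ('h \<Rightarrow> 'x list \<Rightarrow> 'x list) \<Rightarrow> 'h \<Rightarrow> 'x list \<Rightarrow> 'h" where
  "restr_word H A \<phi> h [] = h"
| "restr_word H A \<phi> h (x # v) = restr_word H A \<phi> (restr H A \<phi> h x) v"

definition zappa_szep_product ::
  "('h, 'm) monoid_scheme \<Rightarrow> 'x set \<Rightarrow> ('h \<Rightarrow> 'x list \<Rightarrow> 'x list) \<Rightarrow> ('x list \<times> 'h) monoid" where
  "zappa_szep_product H A \<phi> =
    \<lparr>carrier = lists A \<times> carrier H,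
     monoid.mult = (\<lambda>(v, h) (w, k). (v @ \<phi> h w, restr_word H A \<phi> h w \<otimes>\<^bsub>H\<^esub> k)),
     one = ([], \<one>\<^bsub>H\<^esub>)\<rparr>"

end

theory Submission
  imports Defs "HOL-Algebra.Left_Coset" "HOL-Library.Sublist"
begin

text \<open>
  The principal right ideal of \<open>(g, p)\<close> in \<open>G \<rtimes>\<^sub>\<theta> P\<close> is the product of the coset \<open>g \<theta>\<^sub>p(G)\<close> and
  the ideal \<open>pP\<close>. Let \<open>F\<close> be a foundation set. Every \<open>p \<in> P\<close> has a multiple \<open>p'\<close> that
  lies in \<open>qP\<close> for each \<open>(h, q) \<in> F\<close> with \<open>qP \<inter> p'P \<noteq> {}\<close>; then \<open>G\<close> is covered by the cosets
  \<open>h \<theta>\<^sub>q(G)\<close> with \<open>q \<le> p'\<close>. By B. H. Neumann's lemma those of finite index already cover, and the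
  least common multiple of their \<open>q\<close> again has an image of finite index. These least common
  multiples form a foundation set of \<open>P\<close>; once it is refined to an accurate one \<open>R'\<close> whose elements
  still have images of finite index, pairing each \<open>r \<in> R'\<close> with a transversal of
  \<open>G / \<theta>\<^sub>r(G)\<close> refines \<open>F\<close> accurately. For directed \<open>P\<close> a single least common multiple serves as
  \<open>R'\<close>; if incomparable elements have disjoint ideals, minimal elements do.
\<close>

section \<open>Covers of a group by cosets\<close>

context group
begin

lemma mem_l_coset_iff:
  assumes "subgroup H G" "x \<in> carrier G" "y \<in> carrier G"
  shows "y \<in> x <# H \<longleftrightarrow> inv x \<otimes> y \<in> H"
  using assms subgroup.lcos_module_imp subgroup.lcos_module_rev is_group by metis

lemma l_coset_translate:
  assumes "subgroup H G" "a \<in> carrier G" "t \<in> carrier G" "x \<in> t <# H"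
  shows "a \<otimes> x \<in> (a \<otimes> t) <# H"
  using assms lcos_m_assoc[of H a t] subgroup.subset[of H G] by (auto simp: l_coset_def)

lemma l_coset_eq_of_mem:
  assumes "subgroup H G" "a \<in> carrier G" "b \<in> carrier G" "x \<in> a <# H" "x \<in> b <# H"
  shows "a <# H = b <# H"
  using assms l_repr_independence by metis

text \<open>Left translation by \<open>a \<otimes> inv b\<close> undoes translation by
  \<open>b \<otimes> inv a\<close>, so a cover of one coset of a subgroup can be moved to any other
  coset of it.\<close>

lemma mult_inv_cancel:
  assumes "a \<in> carrier G" "b \<in> carrier G" "x \<in> carrier G"
  shows "(a \<otimes> inv b) \<otimes> ((b \<otimes> inv a) \<otimes> x) = x"
proof -
  have cancel: "c \<otimes> (inv c \<otimes> y) = y" "inv c \<otimes> (c \<otimes> y) = y"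
    if "c \<in> carrier G" "y \<in> carrier G" for c y
    using that by (simp_all add: m_assoc[symmetric])
  show ?thesis
    using assms by (simp add: m_assoc cancel)
qed

section \<open>Subgroups of finite index\<close>

lemma finite_lcosets_carrier: "finite (lcosets (carrier G))"
proof -
  have "lcosets (carrier G) \<subseteq> {carrier G}"
    unfolding LCOSETS_def using coset_join3 subgroup_self by auto
  then show ?thesis
    using finite_subset by blast
qed

text \<open>Each coset of \<open>H \<inter> K\<close> is the intersection of a coset of
  \<open>H\<close> with a coset of \<open>K\<close>, which leaves finitely many
  possibilities.\<close>

lemma finite_lcosets_Int:
  assumes "subgroup H G" "subgroup K G" "finite (lcosets H)" "finite (lcosets K)"
  shows "finite (lcosets (H \<inter> K))"
proof -
  have HK: "subgroup (H \<inter> K) G"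
    using assms(1,2) by (rule subgroups_Inter_pair)
  have "x <# (H \<inter> K) = (x <# H) \<inter> (x <# K)" if x: "x \<in> carrier G" for x
  proof (rule Set.set_eqI)
    fix y
    show "y \<in> x <# (H \<inter> K) \<longleftrightarrow> y \<in> (x <# H) \<inter> (x <# K)"
    proof (cases "y \<in> carrier G")
      case True
      then show ?thesis
        using mem_l_coset_iff[OF HK x] mem_l_coset_iff[OF assms(1) x] mem_l_coset_iff[OF assms(2) x]
        by simp
    next
      case False
      then show ?thesis
        using l_coset_carrier[OF _ x HK] l_coset_carrier[OF _ x assms(1)] by blast
    qed
  qed
  then have "lcosets (H \<inter> K) \<subseteq> (\<lambda>(A, B). A \<inter> B) ` ((lcosets H) \<times> (lcosets K))"
    unfolding LCOSETS_def by auto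
  then show ?thesis
    using assms(3,4) finite_subset by blast
qed

lemma finite_index_transversal:
  assumes H: "subgroup H G" and fin: "finite (lcosets H)"
  obtains T where "finite T" "T \<subseteq> carrier G" "\<And>x. x \<in> carrier G \<Longrightarrow> \<exists>t\<in>T. x \<in> t <# H"
    "\<And>s t. \<lbrakk>s \<in> T; t \<in> T; s \<noteq> t\<rbrakk> \<Longrightarrow> (s <# H) \<inter> (t <# H) = {}"
proof -
  define f where "f C = (SOME a. a \<in> carrier G \<and> C = a <# H)" for C
  have f: "f C \<in> carrier G \<and> C = f C <# H" if "C \<in> lcosets H" for C
    unfolding f_def by (rule someI_ex) (use that in \<open>auto simp: LCOSETS_def\<close>)
  show ?thesis
  proof (rule that[of "f ` (lcosets H)"])
    show "finite (f ` (lcosets H))" using fin by simp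
    show "f ` (lcosets H) \<subseteq> carrier G" using f by auto
    show "\<exists>t\<in>f ` (lcosets H). x \<in> t <# H" if "x \<in> carrier G" for x
      using lcosets_part_G[OF H] that f by blast
    show "(s <# H) \<inter> (t <# H) = {}"
      if "s \<in> f ` (lcosets H)" "t \<in> f ` (lcosets H)" "s \<noteq> t" for s t
      using lcos_disjoint[OF H] that f by (smt (verit) imageE)
  qed
qed

text \<open>Induction on the set of subgroups: some coset of the new subgroup \<open>K\<close> is
  missing from the cover, so cosets of the other subgroups cover it. Translates of this partial
  cover then replace every coset of \<open>K\<close>, and the induction hypothesis is
  contradicted.\<close>

lemma infinite_index_cosets_not_cover:
  assumes "finite \<H>" "\<And>H. H \<in> \<H> \<Longrightarrow> subgroup H G \<and> infinite (lcosets H)"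
    and "finite T" "T \<subseteq> carrier G \<times> \<H>"
  shows "\<not> carrier G \<subseteq> (\<Union>(t, H)\<in>T. t <# H)"
  using assms
proof (induction \<H> arbitrary: T rule: finite_induct)
  case empty
  then show ?case by auto
next
  case (insert K \<H>)
  show ?case
  proof
    assume cover: "carrier G \<subseteq> (\<Union>(t, H)\<in>T. t <# H)"
    have K: "subgroup K G" "infinite (lcosets K)"
      using insert.prems(1) by auto
    have "finite ((\<lambda>(t, H). t <# K) ` T)"
      using insert.prems(2) by simp
    then have "\<not> lcosets K \<subseteq> (\<lambda>(t, H). t <# K) ` T"
      using K(2) finite_subset by blast
    \<comment> \<open>\<open>T\<close> is finite while \<open>K\<close> has infinitely many cosets,
      so some \<open>c <# K\<close> differs from all \<open>t <# K\<close>, hence is disjoint from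
      them.\<close>
    then obtain c where c: "c \<in> carrier G" "c <# K \<notin> (\<lambda>(t, H). t <# K) ` T"
      unfolding LCOSETS_def by auto
    define T0 where "T0 = T \<inter> (carrier G \<times> \<H>)"
    have fin0: "finite T0"
      using insert.prems(2) by (simp add: T0_def)
    have c_cover: "\<exists>(s, H)\<in>T0. y \<in> s <# H" if y: "y \<in> c <# K" for y
    proof -
      have "y \<in> carrier G"
        using y c(1) K(1) l_coset_carrier by blast
      then obtain s H where sH: "(s, H) \<in> T" "y \<in> s <# H"
        using cover by blast
      then have s: "s \<in> carrier G"
        using insert.prems(3) by auto
      have "H \<noteq> K"
      proof
        assume "H = K"
        then have "c <# K = s <# K"
          using l_coset_eq_of_mem[OF K(1) c(1) s y] sH(2) by simp
        then show False
          using c(2) sH(1) by force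
      qed
      then show ?thesis
        using sH insert.prems(3) by (auto simp: T0_def)
    qed
    \<comment> \<open>Translation by \<open>t \<otimes> inv c\<close> carries the cover of
      \<open>c <# K\<close> to a cover of \<open>t <# K\<close>. This is done for every
      \<open>t\<close> in \<open>T\<close>; the additional cosets do no harm.\<close>
    define T1 where "T1 = (\<lambda>((t, _), (s, H)). (t \<otimes> inv c \<otimes> s, H)) ` (T \<times> T0)"
    have T1: "T1 \<subseteq> carrier G \<times> \<H>" "finite T1"
      using insert.prems(2,3) fin0 c(1) by (auto simp: T1_def T0_def)
    have "carrier G \<subseteq> (\<Union>(t, H)\<in>T0 \<union> T1. t <# H)"
    proof
      fix x assume x: "x \<in> carrier G"
      then obtain t H where tH: "(t, H) \<in> T" "x \<in> t <# H"
        using cover by blast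
      then have t: "t \<in> carrier G"
        using insert.prems(3) by auto
      show "x \<in> (\<Union>(t, H)\<in>T0 \<union> T1. t <# H)"
      proof (cases "H = K")
        case True
        have "(c \<otimes> inv t) \<otimes> x \<in> (c \<otimes> inv t \<otimes> t) <# K"
          using l_coset_translate[OF K(1) _ t] tH(2) True c(1) t by blast
        then have "(c \<otimes> inv t) \<otimes> x \<in> c <# K"
          using c(1) t by (simp add: m_assoc)
        then obtain s L where sL: "(s, L) \<in> T0" "(c \<otimes> inv t) \<otimes> x \<in> s <# L"
          using c_cover by blast
        then have s: "s \<in> carrier G" and L: "subgroup L G"
          using insert.prems(1) by (auto simp: T0_def)
        have "(t \<otimes> inv c) \<otimes> ((c \<otimes> inv t) \<otimes> x) \<in> (t \<otimes> inv c \<otimes> s) <# L"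
          using l_coset_translate[OF L _ s sL(2)] c(1) t by blast
        moreover have "(t \<otimes> inv c) \<otimes> ((c \<otimes> inv t) \<otimes> x) = x"
          using mult_inv_cancel t c(1) x by blast
        moreover have "(t \<otimes> inv c \<otimes> s, L) \<in> T1"
          unfolding T1_def using tH(1) sL(1) by force
        ultimately show ?thesis by auto
      next
        case False
        then have "(t, H) \<in> T0"
          using tH(1) insert.prems(3) by (auto simp: T0_def)
        then show ?thesis using tH(2) by auto
      qed
    qed
    moreover have "T0 \<union> T1 \<subseteq> carrier G \<times> \<H>" "finite (T0 \<union> T1)"
      using T1 fin0 by (auto simp: T0_def)
    ultimately show False
      using insert.IH[of "T0 \<union> T1"] insert.prems(1) by blast
  qed
qed

lemma finite_index_common_subgroup:
  assumes "finite \<H>" "\<And>H. H \<in> \<H> \<Longrightarrow> subgroup H G \<and> finite (lcosets H)"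
  shows "\<exists>D. subgroup D G \<and> finite (lcosets D) \<and> (\<forall>H\<in>\<H>. D \<subseteq> H)"
  using assms
proof (induction \<H> rule: finite_induct)
  case empty
  then show ?case
    using subgroup_self finite_lcosets_carrier by blast
next
  case (insert K \<H>)
  then obtain D where "subgroup D G" "finite (lcosets D)" "\<forall>H\<in>\<H>. D \<subseteq> H"
    by auto
  moreover have "subgroup K G" "finite (lcosets K)"
    using insert.prems by auto
  ultimately have "subgroup (D \<inter> K) G" "finite (lcosets (D \<inter> K))" "\<forall>H\<in>insert K \<H>. D \<inter> K \<subseteq> H"
    using subgroups_Inter_pair finite_lcosets_Int by auto
  then show ?case by blast
qed

text \<open>If \<open>x\<close> were missed by all cosets of finite index, so would be its coset of
  a finite-index subgroup \<open>D\<close> contained in all the subgroups of finite index involved.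
  Cosets of infinite index would cover \<open>x <# D\<close>, and finitely many translates of them
  the whole group.\<close>

theorem finite_index_cosets_cover:
  assumes fin: "finite T" and T: "\<And>t H. (t, H) \<in> T \<Longrightarrow> t \<in> carrier G \<and> subgroup H G"
    and cover: "carrier G \<subseteq> (\<Union>(t, H)\<in>T. t <# H)"
    and x: "x \<in> carrier G"
  shows "\<exists>(t, H)\<in>T. finite (lcosets H) \<and> x \<in> t <# H"
proof (rule ccontr)
  assume not: "\<not> ?thesis"
  define \<F> where "\<F> = {H \<in> snd ` T. finite (lcosets H)}"
  have "finite \<F>" "\<And>H. H \<in> \<F> \<Longrightarrow> subgroup H G \<and> finite (lcosets H)"
    using fin T by (auto simp: \<F>_def)
  from finite_index_common_subgroup[OF this]
  obtain D where D: "subgroup D G" "finite (lcosets D)" and D_sub: "\<forall>H\<in>\<F>. D \<subseteq> H"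
    by blast
  define T0 where "T0 = {(t, H) \<in> T. infinite (lcosets H)}"
  have fin0: "finite T0"
    using fin by (rule rev_finite_subset) (auto simp: T0_def)
  have xD: "\<exists>(s, H)\<in>T0. y \<in> s <# H" if y: "y \<in> x <# D" for y
  proof -
    have yG: "y \<in> carrier G"
      using y x D(1) l_coset_carrier by blast
    then obtain s H where sH: "(s, H) \<in> T" "y \<in> s <# H"
      using cover by blast
    note s = T[OF sH(1)]
    have "infinite (lcosets H)"
    proof
      assume fH: "finite (lcosets H)"
      \<comment> \<open>A finite-index coset \<open>s <# H\<close> containing a point of
        \<open>x <# D\<close> equals \<open>x <# H\<close>, so it would contain
        \<open>x\<close>.\<close>
      then have "D \<subseteq> H" using D_sub sH(1) by (force simp: \<F>_def)
      then have "y \<in> x <# H"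
        using y by (auto simp: l_coset_def)
      then have "x <# H = s <# H"
        using l_coset_eq_of_mem x s sH(2) by blast
      then have "x \<in> s <# H"
        using lcos_self x s by blast
      then show False using not fH sH(1) by blast
    qed
    then show ?thesis
      using sH by (auto simp: T0_def)
  qed
  obtain A where A: "finite A" "A \<subseteq> carrier G" "\<And>y. y \<in> carrier G \<Longrightarrow> \<exists>a\<in>A. y \<in> a <# D"
    using finite_index_transversal[OF D] by metis
  define T1 where "T1 = (\<lambda>(a, (s, H)). (a \<otimes> inv x \<otimes> s, H)) ` (A \<times> T0)"
  have "carrier G \<subseteq> (\<Union>(t, H)\<in>T1. t <# H)"
  proof
    fix y assume y: "y \<in> carrier G"
    then obtain a where a: "a \<in> A" "y \<in> a <# D" using A(3) by blast
    then have aG: "a \<in> carrier G" using A(2) by blast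
    have "(x \<otimes> inv a) \<otimes> y \<in> (x \<otimes> inv a \<otimes> a) <# D"
      using l_coset_translate[OF D(1) _ aG a(2)] x aG by blast
    then have "(x \<otimes> inv a) \<otimes> y \<in> x <# D"
      using x aG by (simp add: m_assoc)
    then obtain s L where sL: "(s, L) \<in> T0" "(x \<otimes> inv a) \<otimes> y \<in> s <# L"
      using xD by blast
    then have s: "s \<in> carrier G" and L: "subgroup L G"
      using T by (auto simp: T0_def)
    have "(a \<otimes> inv x) \<otimes> ((x \<otimes> inv a) \<otimes> y) \<in> (a \<otimes> inv x \<otimes> s) <# L"
      using l_coset_translate[OF L _ s sL(2)] x aG by blast
    moreover have "(a \<otimes> inv x) \<otimes> ((x \<otimes> inv a) \<otimes> y) = y"
      using mult_inv_cancel aG x y by blast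
    moreover have "(a \<otimes> inv x \<otimes> s, L) \<in> T1"
      unfolding T1_def using a(1) sL(1) by force
    ultimately show "y \<in> (\<Union>(t, H)\<in>T1. t <# H)" by auto
  qed
  moreover have "a \<otimes> inv x \<otimes> s \<in> carrier G" if "a \<in> A" "(s, H) \<in> T0" for a s H
    using that A(2) T[of s H] x by (auto simp: T0_def)
  then have "T1 \<subseteq> carrier G \<times> snd ` T0"
    unfolding T1_def by (auto intro: rev_image_eqI)
  moreover have "finite T1"
    using A(1) fin0 by (simp add: T1_def)
  moreover have "subgroup H G \<and> infinite (lcosets H)" if "H \<in> snd ` T0" for H
    using that T by (auto simp: T0_def)
  ultimately show False
    using infinite_index_cosets_not_cover[of "snd ` T0" T1] fin0 by blast
qed

end

section \<open>Principal right ideals\<close>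

lemma mem_principal_right_ideal_iff:
  "y \<in> principal_right_ideal P p \<longleftrightarrow> (\<exists>x\<in>carrier P. y = p \<otimes>\<^bsub>P\<^esub> x)"
  by (auto simp: l_coset_def)

context monoid
begin

lemma principal_right_ideal_self: "p \<in> carrier G \<Longrightarrow> p \<in> principal_right_ideal G p"
  unfolding mem_principal_right_ideal_iff by (rule bexI[of _ \<one>]) auto

lemma principal_right_ideal_closed:
  "\<lbrakk>p \<in> carrier G; q \<in> principal_right_ideal G p\<rbrakk> \<Longrightarrow> q \<in> carrier G"
  by (auto simp: l_coset_def)

lemma principal_right_ideal_trans:
  assumes "p \<in> carrier G" "q \<in> principal_right_ideal G p" "r \<in> principal_right_ideal G q"
  shows "r \<in> principal_right_ideal G p"
  using assms unfolding mem_principal_right_ideal_iff by (metis m_assoc m_closed)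

text \<open>Handle the elements of \<open>A\<close> one at a time, replacing the current
  \<open>q\<close> by a common multiple with \<open>a\<close> if there is one. Both alternatives
  persist on passing to multiples of \<open>q\<close>.\<close>

lemma exists_multiple_deciding_ideals:
  assumes p: "p \<in> carrier G" and A: "finite A" "A \<subseteq> carrier G"
  obtains q where "q \<in> principal_right_ideal G p"
    "\<And>a. a \<in> A \<Longrightarrow> principal_right_ideal G a \<inter> principal_right_ideal G q = {} \<or>
      q \<in> principal_right_ideal G a"
proof -
  have "\<exists>q\<in>principal_right_ideal G p. \<forall>a\<in>A.
      principal_right_ideal G a \<inter> principal_right_ideal G q = {} \<or> q \<in> principal_right_ideal G a"
    using A
  proof (induction A rule: finite_induct)
    case empty
    then show ?case
      using principal_right_ideal_self[OF p] by blast
  next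
    case (insert a A)
    then obtain q where q: "q \<in> principal_right_ideal G p"
      and q': "\<forall>b\<in>A. principal_right_ideal G b \<inter> principal_right_ideal G q = {} \<or>
        q \<in> principal_right_ideal G b"
      by auto
    have qG: "q \<in> carrier G"
      using principal_right_ideal_closed[OF p q] .
    show ?case
    proof (cases "principal_right_ideal G a \<inter> principal_right_ideal G q = {}")
      case True
      then show ?thesis using q q' by blast
    next
      case False
      then obtain r where r: "r \<in> principal_right_ideal G a" "r \<in> principal_right_ideal G q"
        by blast
      have "r \<in> principal_right_ideal G p"
        using principal_right_ideal_trans[OF p q r(2)] .
      moreover have "principal_right_ideal G b \<inter> principal_right_ideal G r = {} \<or>
          r \<in> principal_right_ideal G b" if "b \<in> A" for b
        using q' that insert.prems principal_right_ideal_trans[OF qG r(2)]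
          principal_right_ideal_trans[of b q r] r(2) by blast
      ultimately show ?thesis using r(1) by blast
    qed
  qed
  then show ?thesis using that by blast
qed

end

lemma carrier_semidirect_product: "carrier (semidirect_product G P \<theta>) = carrier G \<times> carrier P"
  by (simp add: semidirect_product_def)

lemma principal_right_ideal_semidirect_product:
  "principal_right_ideal (semidirect_product G P \<theta>) (g, p) =
    (g <#\<^bsub>G\<^esub> \<theta> p ` carrier G) \<times> principal_right_ideal P p"
  by (auto simp: semidirect_product_def l_coset_def)


section \<open>Accurate refinements in semidirect products\<close>

context algebraic_dynamical_system
begin

text \<open>These are the elements \<open>p\<close> for which finitely many first coordinates
  suffice to meet every coset of the image of \<open>\<theta> p\<close>.\<close>

definition finite_index_elements :: "'p set" where
  "finite_index_elements = {p \<in> carrier P. finite (lcosets\<^bsub>G\<^esub> (\<theta> p ` carrier G))}"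

lemma endo_image_subgroup: "p \<in> carrier P \<Longrightarrow> subgroup (\<theta> p ` carrier G) G"
  using endo G.is_group by (auto intro!: group_hom.img_is_subgroup simp: group_hom_def group_hom_axioms_def)

lemma endo_image_antimono:
  assumes "p \<in> carrier P" "q \<in> principal_right_ideal P p"
  shows "\<theta> q ` carrier G \<subseteq> \<theta> p ` carrier G"
proof -
  obtain x where x: "x \<in> carrier P" "q = p \<otimes>\<^bsub>P\<^esub> x"
    using assms(2) unfolding mem_principal_right_ideal_iff by blast
  have "\<theta> q g = \<theta> p (\<theta> x g)" if "g \<in> carrier G" for g
    using action_mult assms(1) x that by simp
  moreover have "\<theta> x g \<in> carrier G" if "g \<in> carrier G" for g
    using endo[OF x(1)] that by (auto simp: hom_def)
  ultimately show ?thesis by auto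
qed

lemma finite_index_one: "\<one>\<^bsub>P\<^esub> \<in> finite_index_elements"
proof -
  have "\<theta> \<one>\<^bsub>P\<^esub> ` carrier G = carrier G"
    using action_one by force
  then show ?thesis
    using G.finite_lcosets_carrier by (simp add: finite_index_elements_def)
qed

text \<open>By \<open>preserves_order\<close>, the image belonging to a least common multiple is the
  intersection of the two images.\<close>

lemma finite_index_lcm:
  assumes "p \<in> finite_index_elements" "q \<in> finite_index_elements"
    and r: "r \<in> carrier P" "principal_right_ideal P p \<inter> principal_right_ideal P q = principal_right_ideal P r"
  shows "r \<in> finite_index_elements"
proof -
  have pq: "p \<in> carrier P" "q \<in> carrier P"
    using assms by (auto simp: finite_index_elements_def)
  then have "\<theta> p ` carrier G \<inter> \<theta> q ` carrier G = \<theta> r ` carrier G"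
    using preserves_order r by blast
  then show ?thesis
    using assms(1,2) G.finite_lcosets_Int[OF endo_image_subgroup[OF pq(1)] endo_image_subgroup[OF pq(2)]] r(1)
    by (simp add: finite_index_elements_def)
qed

text \<open>The common multiple \<open>p\<close> keeps each intersection of ideals nonempty, so the
  right LCM property supplies a generator at each step.\<close>

lemma finite_index_finite_lcm:
  assumes "finite Q" "Q \<subseteq> finite_index_elements" "p \<in> carrier P"
    "\<And>q. q \<in> Q \<Longrightarrow> p \<in> principal_right_ideal P q"
  shows "\<exists>r\<in>finite_index_elements. \<forall>x\<in>carrier P.
    x \<in> principal_right_ideal P r \<longleftrightarrow> (\<forall>q\<in>Q. x \<in> principal_right_ideal P q)"
  using assms
proof (induction Q rule: finite_induct)
  case empty
  have "x \<in> principal_right_ideal P \<one>\<^bsub>P\<^esub>" if "x \<in> carrier P" for x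
    using that unfolding mem_principal_right_ideal_iff by auto
  then show ?case using finite_index_one by blast
next
  case (insert a Q)
  then obtain r where r: "r \<in> finite_index_elements"
    and r_iff: "\<forall>x\<in>carrier P. x \<in> principal_right_ideal P r \<longleftrightarrow> (\<forall>q\<in>Q. x \<in> principal_right_ideal P q)"
    by auto
  have a: "a \<in> finite_index_elements" using insert.prems by blast
  have "p \<in> principal_right_ideal P r \<inter> principal_right_ideal P a"
    using r_iff insert.prems by blast
  then obtain s where s: "s \<in> carrier P"
    "principal_right_ideal P r \<inter> principal_right_ideal P a = principal_right_ideal P s"
    using P.right_lcm[of r a] r a unfolding finite_index_elements_def by blast
  have "s \<in> finite_index_elements"
    using finite_index_lcm[OF r a s] .
  then show ?case
    using s(2) r_iff by blast
qed

text \<open>The elements of \<open>R\<close> are least common multiples of sets of second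
  coordinates of \<open>F\<close>. Neumann's lemma is what allows these sets to consist of elements
  of finite index.\<close>

lemma foundation_set_finite_index:
  assumes F: "foundation_set (semidirect_product G P \<theta>) F"
  obtains R where "foundation_set P R" "R \<subseteq> finite_index_elements"
    "\<And>r g. \<lbrakk>r \<in> R; g \<in> carrier G\<rbrakk> \<Longrightarrow>
      \<exists>f\<in>F. (g, r) \<in> principal_right_ideal (semidirect_product G P \<theta>) f"
proof -
  have fin: "finite F" and sub: "F \<subseteq> carrier G \<times> carrier P"
    using F by (auto simp: foundation_set_def carrier_semidirect_product)
  define common where "common Q p \<longleftrightarrow> p \<in> carrier P \<and> (\<forall>q\<in>Q. p \<in> principal_right_ideal P q)" for Q p
  define \<Q> where "\<Q> = {Q. Q \<subseteq> snd ` F \<inter> finite_index_elements \<and> (\<exists>p. common Q p)}"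
  have fin\<Q>: "finite \<Q>"
    using fin by (auto simp: \<Q>_def intro: rev_finite_subset[of "Pow (snd ` F)"])
  define is_lcm where "is_lcm Q r \<longleftrightarrow> r \<in> finite_index_elements \<and>
    (\<forall>x\<in>carrier P. x \<in> principal_right_ideal P r \<longleftrightarrow> (\<forall>q\<in>Q. x \<in> principal_right_ideal P q))" for Q r
  have "\<exists>r. is_lcm Q r" if Q\<Q>: "Q \<in> \<Q>" for Q
  proof -
    have Q: "finite Q" "Q \<subseteq> finite_index_elements"
      using Q\<Q> fin by (auto simp: \<Q>_def intro: rev_finite_subset[of "snd ` F"])
    obtain p where "common Q p"
      using Q\<Q> unfolding \<Q>_def by blast
    then have "p \<in> carrier P" "\<And>q. q \<in> Q \<Longrightarrow> p \<in> principal_right_ideal P q"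
      by (simp_all add: common_def)
    from finite_index_finite_lcm[OF Q this] show ?thesis
      by (simp add: is_lcm_def Bex_def)
  qed
  then have "\<forall>Q\<in>\<Q>. \<exists>r. is_lcm Q r"
    by blast
  from bchoice[OF this] obtain l where "\<forall>Q\<in>\<Q>. is_lcm Q (l Q)"
    by blast
  then have l: "\<And>Q. Q \<in> \<Q> \<Longrightarrow> l Q \<in> finite_index_elements"
    and l_iff: "\<And>Q x. \<lbrakk>Q \<in> \<Q>; x \<in> carrier P\<rbrakk> \<Longrightarrow>
      x \<in> principal_right_ideal P (l Q) \<longleftrightarrow> (\<forall>q\<in>Q. x \<in> principal_right_ideal P q)"
    by (simp_all add: is_lcm_def)
  have lP: "l Q \<in> carrier P" if "Q \<in> \<Q>" for Q
    using l[OF that] by (simp add: finite_index_elements_def)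
  \<comment> \<open>This selects the sets \<open>Q\<close> for which every \<open>g\<close> lies in
    a coset belonging to some \<open>q \<in> Q\<close>; then each \<open>(g, l Q)\<close> is a
    multiple of an element of \<open>F\<close>.\<close>
  define covers where "covers Q \<longleftrightarrow>
    (\<forall>g\<in>carrier G. \<exists>(h, q)\<in>F. q \<in> Q \<and> g \<in> h <#\<^bsub>G\<^esub> \<theta> q ` carrier G)" for Q
  define R where "R = l ` {Q \<in> \<Q>. covers Q}"
  show ?thesis
  proof (rule that[of R])
    show "R \<subseteq> finite_index_elements"
      using l by (auto simp: R_def)
    show "\<exists>f\<in>F. (g, r) \<in> principal_right_ideal (semidirect_product G P \<theta>) f"
      if r: "r \<in> R" and g: "g \<in> carrier G" for r g
    proof -
      obtain Q where Q: "Q \<in> \<Q>" "covers Q" "r = l Q"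
        using r by (auto simp: R_def)
      then obtain h q where hq: "(h, q) \<in> F" "q \<in> Q" "g \<in> h <#\<^bsub>G\<^esub> \<theta> q ` carrier G"
        using g unfolding covers_def by blast
      have "r \<in> principal_right_ideal P q"
        using l_iff[OF Q(1) lP[OF Q(1)]] P.principal_right_ideal_self[OF lP[OF Q(1)]] hq(2) Q(3) by blast
      then show ?thesis
        using hq(1,3) by (intro bexI[of _ "(h, q)"]) (simp_all add: principal_right_ideal_semidirect_product)
    qed
    show "foundation_set P R"
      unfolding foundation_set_def
    proof (intro conjI ballI)
      show "finite R" using fin\<Q> by (simp add: R_def)
      show "R \<subseteq> carrier P" using lP by (auto simp: R_def)
      fix p assume p: "p \<in> carrier P"
      have "finite (snd ` F)" "snd ` F \<subseteq> carrier P"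
        using fin sub by auto
      from P.exists_multiple_deciding_ideals[OF p this]
      obtain p' where p': "p' \<in> principal_right_ideal P p"
        and good: "\<And>q. q \<in> snd ` F \<Longrightarrow> principal_right_ideal P q \<inter> principal_right_ideal P p' = {} \<or>
          p' \<in> principal_right_ideal P q"
        by blast
      have p'P: "p' \<in> carrier P"
        using P.principal_right_ideal_closed[OF p p'] .
      \<comment> \<open>The cosets attached to the elements of \<open>F\<close> whose second
        coordinate divides \<open>p'\<close>; the foundation property, applied to
        \<open>(g, p')\<close> for each \<open>g\<close>, shows that they cover
        \<open>G\<close>.\<close>
      define T where "T = (\<lambda>(h, q). (h, \<theta> q ` carrier G)) ` {(h, q) \<in> F. p' \<in> principal_right_ideal P q}"
      have cover: "carrier G \<subseteq> (\<Union>(t, H)\<in>T. t <#\<^bsub>G\<^esub> H)"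
      proof
        fix g assume g: "g \<in> carrier G"
        then have "(g, p') \<in> carrier (semidirect_product G P \<theta>)"
          using p'P by (simp add: carrier_semidirect_product)
        then obtain h q where hq: "(h, q) \<in> F"
          "principal_right_ideal (semidirect_product G P \<theta>) (g, p') \<inter>
            principal_right_ideal (semidirect_product G P \<theta>) (h, q) \<noteq> {}"
          using F unfolding foundation_set_def by fast
        have hqc: "h \<in> carrier G" "q \<in> carrier P"
          using hq(1) sub by auto
        have "principal_right_ideal P q \<inter> principal_right_ideal P p' \<noteq> {}"
          using hq(2) unfolding principal_right_ideal_semidirect_product by blast
        \<comment> \<open>By the choice of \<open>p'\<close>, meeting the ideal of \<open>q\<close>
          already means being a multiple of \<open>q\<close>.\<close>
        then have p'q: "p' \<in> principal_right_ideal P q"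
          using good[of q] hq(1) by force
        obtain y where y: "y \<in> g <#\<^bsub>G\<^esub> \<theta> p' ` carrier G" "y \<in> h <#\<^bsub>G\<^esub> \<theta> q ` carrier G"
          using hq(2) unfolding principal_right_ideal_semidirect_product by blast
        have sg: "subgroup (\<theta> q ` carrier G) G"
          using endo_image_subgroup hqc(2) .
        \<comment> \<open>As \<open>p'\<close> is a multiple of \<open>q\<close>, its image is the
          smaller one, so the common point \<open>y\<close> makes the
          \<open>\<theta> q\<close>-cosets of \<open>g\<close> and \<open>h\<close>
          coincide.\<close>
        have "y \<in> g <#\<^bsub>G\<^esub> \<theta> q ` carrier G"
          using y(1) endo_image_antimono[OF hqc(2) p'q] unfolding l_coset_def by blast
        then have "g \<in> h <#\<^bsub>G\<^esub> \<theta> q ` carrier G"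
          using G.l_coset_eq_of_mem[OF sg g hqc(1) _ y(2)] G.lcos_self[OF g sg] by simp
        moreover have "(h, \<theta> q ` carrier G) \<in> T"
          unfolding T_def using hq(1) p'q by force
        ultimately show "g \<in> (\<Union>(t, H)\<in>T. t <#\<^bsub>G\<^esub> H)" by blast
      qed
      have "finite {(h, q) \<in> F. p' \<in> principal_right_ideal P q}"
        using fin by (rule rev_finite_subset) auto
      then have finT: "finite T" by (simp add: T_def)
      have T: "t \<in> carrier G \<and> subgroup H G" if "(t, H) \<in> T" for t H
        using that sub endo_image_subgroup by (auto simp: T_def)
      \<comment> \<open>All finite-index second coordinates dividing \<open>p'\<close>;
        \<open>p'\<close> itself is the common multiple that puts \<open>Q\<close> into
        \<open>\<Q>\<close>.\<close>
      define Q where "Q = {q \<in> snd ` F \<inter> finite_index_elements. p' \<in> principal_right_ideal P q}"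
      have Q: "Q \<in> \<Q>"
        using p'P by (auto simp: \<Q>_def common_def Q_def)
      have "covers Q"
        unfolding covers_def
      proof
        fix g assume "g \<in> carrier G"
        then obtain t H where tH: "(t, H) \<in> T" "finite (lcosets\<^bsub>G\<^esub> H)" "g \<in> t <#\<^bsub>G\<^esub> H"
          using G.finite_index_cosets_cover[OF finT T cover] by blast
        then obtain q where q: "(t, q) \<in> F" "p' \<in> principal_right_ideal P q" "H = \<theta> q ` carrier G"
          by (auto simp: T_def)
        have "q \<in> Q"
          using q tH(2) sub by (force simp: Q_def finite_index_elements_def)
        then show "\<exists>(h, q)\<in>F. q \<in> Q \<and> g \<in> h <#\<^bsub>G\<^esub> \<theta> q ` carrier G"
          using q tH(3) by blast
      qed
      then have "l Q \<in> R"
        using Q by (auto simp: R_def)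
      moreover have "p' \<in> principal_right_ideal P (l Q)"
        using l_iff[OF Q p'P] by (auto simp: Q_def)
      ultimately show "\<exists>t\<in>R. principal_right_ideal P p \<inter> principal_right_ideal P t \<noteq> {}"
        using p' by blast
    qed
  qed
qed

text \<open>This reduces (AR) to a refinement problem in \<open>P\<close> alone. Finite index of the
  elements of \<open>R'\<close> is what keeps the transversals, and with them \<open>F'\<close>,
  finite.\<close>

lemma accurate_refinement_propertyI:
  assumes refine: "\<And>R. \<lbrakk>foundation_set P R; R \<subseteq> finite_index_elements\<rbrakk> \<Longrightarrow>
    \<exists>R'. accurate_foundation_set P R' \<and> R' \<subseteq> finite_index_elements \<and>
      (\<forall>r'\<in>R'. \<exists>r\<in>R. r' \<in> principal_right_ideal P r)"
  shows "accurate_refinement_property (semidirect_product G P \<theta>)"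
  unfolding accurate_refinement_property_def
proof (intro allI impI)
  fix F assume F: "foundation_set (semidirect_product G P \<theta>) F"
  then obtain R where R: "foundation_set P R" "R \<subseteq> finite_index_elements"
    and R_refines: "\<And>r g. \<lbrakk>r \<in> R; g \<in> carrier G\<rbrakk> \<Longrightarrow>
      \<exists>f\<in>F. (g, r) \<in> principal_right_ideal (semidirect_product G P \<theta>) f"
    using foundation_set_finite_index by metis
  then obtain R' where R': "accurate_foundation_set P R'" "R' \<subseteq> finite_index_elements"
    and R'_refines: "\<And>r'. r' \<in> R' \<Longrightarrow> \<exists>r\<in>R. r' \<in> principal_right_ideal P r"
    using refine by metis
  have R'P: "R' \<subseteq> carrier P" and finR': "finite R'"
    using R'(1) by (auto simp: accurate_foundation_set_def foundation_set_def)
  have "\<exists>T. finite T \<and> T \<subseteq> carrier G \<and> (\<forall>x\<in>carrier G. \<exists>t\<in>T. x \<in> t <#\<^bsub>G\<^esub> \<theta> r ` carrier G) \<and>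
      (\<forall>s\<in>T. \<forall>t\<in>T. s \<noteq> t \<longrightarrow> (s <#\<^bsub>G\<^esub> \<theta> r ` carrier G) \<inter> (t <#\<^bsub>G\<^esub> \<theta> r ` carrier G) = {})"
    if "r \<in> R'" for r
  proof -
    have "subgroup (\<theta> r ` carrier G) G" "finite (lcosets\<^bsub>G\<^esub> (\<theta> r ` carrier G))"
      using that R'(2) endo_image_subgroup by (auto simp: finite_index_elements_def)
    from G.finite_index_transversal[OF this] show ?thesis by metis
  qed
  then obtain T where T: "\<And>r. r \<in> R' \<Longrightarrow> finite (T r)" "\<And>r. r \<in> R' \<Longrightarrow> T r \<subseteq> carrier G"
    and T_cover: "\<And>r x. \<lbrakk>r \<in> R'; x \<in> carrier G\<rbrakk> \<Longrightarrow> \<exists>t\<in>T r. x \<in> t <#\<^bsub>G\<^esub> \<theta> r ` carrier G"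
    and T_disj: "\<And>r s t. \<lbrakk>r \<in> R'; s \<in> T r; t \<in> T r; s \<noteq> t\<rbrakk> \<Longrightarrow>
      (s <#\<^bsub>G\<^esub> \<theta> r ` carrier G) \<inter> (t <#\<^bsub>G\<^esub> \<theta> r ` carrier G) = {}"
    by metis
  define F' where "F' = {(t, r). r \<in> R' \<and> t \<in> T r}"
  have "F' = prod.swap ` (SIGMA r:R'. T r)"
    by (force simp: F'_def)
  then have "finite F'"
    using finR' T(1) by simp
  moreover have "F' \<subseteq> carrier G \<times> carrier P"
    using T(2) R'P by (auto simp: F'_def)
  moreover have "\<exists>f\<in>F'. principal_right_ideal (semidirect_product G P \<theta>) (g, p) \<inter>
      principal_right_ideal (semidirect_product G P \<theta>) f \<noteq> {}"
    if g: "g \<in> carrier G" and p: "p \<in> carrier P" for g p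
  proof -
    obtain r where r: "r \<in> R'" "principal_right_ideal P p \<inter> principal_right_ideal P r \<noteq> {}"
      using R'(1) p unfolding accurate_foundation_set_def foundation_set_def by blast
    obtain t where t: "t \<in> T r" "g \<in> t <#\<^bsub>G\<^esub> \<theta> r ` carrier G"
      using T_cover[OF r(1) g] by blast
    moreover have "g \<in> g <#\<^bsub>G\<^esub> \<theta> p ` carrier G"
      using G.lcos_self[OF g endo_image_subgroup[OF p]] .
    ultimately have "principal_right_ideal (semidirect_product G P \<theta>) (g, p) \<inter>
      principal_right_ideal (semidirect_product G P \<theta>) (t, r) \<noteq> {}"
      using r(2) unfolding principal_right_ideal_semidirect_product by blast
    then show ?thesis
      using r(1) t(1) by (auto simp: F'_def)
  qed
  moreover have "principal_right_ideal (semidirect_product G P \<theta>) a \<inter>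
      principal_right_ideal (semidirect_product G P \<theta>) b = {}"
    if a: "a \<in> F'" and b: "b \<in> F'" and neq: "a \<noteq> b" for a b
  proof -
    obtain s p t q where ab: "a = (s, p)" "b = (t, q)" "p \<in> R'" "q \<in> R'" "s \<in> T p" "t \<in> T q"
      using a b by (auto simp: F'_def)
    show ?thesis
    \<comment> \<open>With equal second coordinates the cosets of a transversal are disjoint; with
      distinct ones the ideals in \<open>P\<close> are.\<close>
    proof (cases "p = q")
      case True
      then show ?thesis
        using T_disj[of p s t] ab neq unfolding ab(1,2) principal_right_ideal_semidirect_product
        by blast
    next
      case False
      then have "principal_right_ideal P p \<inter> principal_right_ideal P q = {}"
        using R'(1) ab(3,4) unfolding accurate_foundation_set_def by blast
      then show ?thesis
        unfolding ab(1,2) principal_right_ideal_semidirect_product by blast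
    qed
  qed
  ultimately have "accurate_foundation_set (semidirect_product G P \<theta>) F'"
    unfolding accurate_foundation_set_def foundation_set_def carrier_semidirect_product
    by (intro conjI) auto
  moreover have "\<exists>f\<in>F. f' \<in> principal_right_ideal (semidirect_product G P \<theta>) f" if f': "f' \<in> F'" for f'
  proof -
    obtain t r' where f'_eq: "f' = (t, r')" "r' \<in> R'" "t \<in> T r'"
      using f' by (auto simp: F'_def)
    have t: "t \<in> carrier G" using f'_eq T(2) by blast
    obtain r where r: "r \<in> R" "r' \<in> principal_right_ideal P r"
      using R'_refines f'_eq(2) by blast
    obtain h q where hq: "(h, q) \<in> F"
      "(t, r) \<in> principal_right_ideal (semidirect_product G P \<theta>) (h, q)"
      using R_refines[OF r(1) t] by (metis surj_pair)
    \<comment> \<open>The first coordinate \<open>t\<close> is the same for \<open>r\<close> and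
      \<open>r'\<close>, so only the second one has to be passed on by transitivity.\<close>
    have "q \<in> carrier P"
      using hq(1) F by (auto simp: foundation_set_def carrier_semidirect_product)
    then have "(t, r') \<in> principal_right_ideal (semidirect_product G P \<theta>) (h, q)"
      using hq(2) r(2) P.principal_right_ideal_trans
      unfolding principal_right_ideal_semidirect_product by blast
    then show ?thesis using hq(1) f'_eq(1) by blast
  qed
  ultimately show "\<exists>F'. accurate_foundation_set (semidirect_product G P \<theta>) F' \<and>
      (\<forall>f'\<in>F'. \<exists>f\<in>F. f' \<in> principal_right_ideal (semidirect_product G P \<theta>) f)"
    by blast
qed

theorem accurate_refinement_directed:
  assumes dir: "directed_monoid P"
  shows "accurate_refinement_property (semidirect_product G P \<theta>)"
proof (rule accurate_refinement_propertyI)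
  fix R assume R: "foundation_set P R" "R \<subseteq> finite_index_elements"
  have finR: "finite R" "R \<subseteq> carrier P"
    using R(1) by (auto simp: foundation_set_def)
  \<comment> \<open>Start from the identity: directedness rules out the disjoint alternative, which
    makes \<open>p\<close> a common multiple of all of \<open>R\<close>.\<close>
  obtain p where p: "p \<in> principal_right_ideal P \<one>\<^bsub>P\<^esub>"
    and "\<And>a. a \<in> R \<Longrightarrow> principal_right_ideal P a \<inter> principal_right_ideal P p = {} \<or>
      p \<in> principal_right_ideal P a"
    using P.exists_multiple_deciding_ideals[OF P.one_closed finR] by blast
  moreover have pP: "p \<in> carrier P"
    using P.principal_right_ideal_closed[OF P.one_closed p] .
  ultimately have common: "\<And>a. a \<in> R \<Longrightarrow> p \<in> principal_right_ideal P a"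
    using dir finR(2) unfolding directed_monoid_def by blast
  obtain r where r: "r \<in> finite_index_elements"
    and r_iff: "\<forall>x\<in>carrier P. x \<in> principal_right_ideal P r \<longleftrightarrow> (\<forall>q\<in>R. x \<in> principal_right_ideal P q)"
    using finite_index_finite_lcm[OF finR(1) R(2) pP common] by blast
  have rP: "r \<in> carrier P"
    using r by (simp add: finite_index_elements_def)
  obtain q where "q \<in> R"
    using R(1) P.one_closed unfolding foundation_set_def by blast
  moreover have "r \<in> principal_right_ideal P q" if "q \<in> R" for q
    using r_iff rP P.principal_right_ideal_self that by blast
  moreover have "accurate_foundation_set P {r}"
    using rP dir by (simp add: accurate_foundation_set_def foundation_set_def directed_monoid_def)
  ultimately show "\<exists>R'. accurate_foundation_set P R' \<and> R' \<subseteq> finite_index_elements \<and>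
      (\<forall>r'\<in>R'. \<exists>r\<in>R. r' \<in> principal_right_ideal P r)"
    using r by (intro exI[of _ "{r}"]) auto
qed

end

section \<open>Incomparable elements with disjoint ideals\<close>

context monoid
begin

text \<open>
  \<open>R'\<close> consists of minimal elements of \<open>R\<close>, but not of all of them: distinct elements
  may generate the same ideal.
\<close>

lemma accurate_subset:
  assumes "incomparable_disjoint G" "finite R" "R \<subseteq> carrier G"
  obtains R' where "R' \<subseteq> R" "\<And>r. r \<in> R \<Longrightarrow> \<exists>r'\<in>R'. r \<in> principal_right_ideal G r'"
    "\<And>s t. \<lbrakk>s \<in> R'; t \<in> R'; s \<noteq> t\<rbrakk> \<Longrightarrow> principal_right_ideal G s \<inter> principal_right_ideal G t = {}"
proof -
  have "\<exists>R'\<subseteq>R. (\<forall>r\<in>R. \<exists>r'\<in>R'. r \<in> principal_right_ideal G r') \<and>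
    (\<forall>s\<in>R'. \<forall>t\<in>R'. s \<noteq> t \<longrightarrow> principal_right_ideal G s \<inter> principal_right_ideal G t = {})"
    using assms(2,3)
  proof (induction R rule: finite_induct)
    case empty
    then show ?case by auto
  next
    case (insert a R)
    then obtain R' where R': "R' \<subseteq> R" "\<forall>r\<in>R. \<exists>r'\<in>R'. r \<in> principal_right_ideal G r'"
      "\<forall>s\<in>R'. \<forall>t\<in>R'. s \<noteq> t \<longrightarrow> principal_right_ideal G s \<inter> principal_right_ideal G t = {}"
      by auto
    have a: "a \<in> carrier G" and RG: "R' \<subseteq> carrier G" using insert.prems R'(1) by auto
    show ?case
    proof (cases "\<exists>r'\<in>R'. a \<in> principal_right_ideal G r'")
      case True
      then show ?thesis using R' by (intro exI[of _ R']) auto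
    next
      case False
      \<comment> \<open>No element of \<open>R'\<close> divides \<open>a\<close>, so
        \<open>a\<close> enters and displaces its multiples; whatever they divided is divided by
        \<open>a\<close>. The elements kept are incomparable with \<open>a\<close>.\<close>
      define R'' where "R'' = insert a {r \<in> R'. r \<notin> principal_right_ideal G a}"
      have disj: "principal_right_ideal G a \<inter> principal_right_ideal G t = {}"
        if "t \<in> R'" "t \<notin> principal_right_ideal G a" for t
        using assms(1) that False a RG
        unfolding incomparable_disjoint_def comparable_def rdiv_le_def by blast
      have "\<exists>r''\<in>R''. r \<in> principal_right_ideal G r''" if r: "r \<in> insert a R" for r
      proof (cases "r = a")
        case True
        then show ?thesis using principal_right_ideal_self[OF a] by (auto simp: R''_def)
      next
        case False
        then obtain r' where "r' \<in> R'" "r \<in> principal_right_ideal G r'"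
          using R'(2) r by blast
        then show ?thesis
          using principal_right_ideal_trans[OF a, of r' r] by (auto simp: R''_def)
      qed
      moreover have "R'' \<subseteq> insert a R" using R'(1) by (auto simp: R''_def)
      moreover have "\<forall>s\<in>R''. \<forall>t\<in>R''. s \<noteq> t \<longrightarrow>
          principal_right_ideal G s \<inter> principal_right_ideal G t = {}"
        using R'(3) disj unfolding R''_def by blast
      ultimately show ?thesis by blast
    qed
  qed
  then show ?thesis using that by blast
qed

end

text \<open>A subset of \<open>R\<close> suffices here, so finite index is inherited without forming
  further least common multiples.\<close>

theorem (in algebraic_dynamical_system) accurate_refinement_incomparable_disjoint:
  assumes inc: "incomparable_disjoint P"
  shows "accurate_refinement_property (semidirect_product G P \<theta>)"
proof (rule accurate_refinement_propertyI)
  fix R assume R: "foundation_set P R" "R \<subseteq> finite_index_elements"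
  have finR: "finite R" "R \<subseteq> carrier P"
    using R(1) by (auto simp: foundation_set_def)
  obtain R' where R': "R' \<subseteq> R" "\<And>r. r \<in> R \<Longrightarrow> \<exists>r'\<in>R'. r \<in> principal_right_ideal P r'"
    "\<And>s t. \<lbrakk>s \<in> R'; t \<in> R'; s \<noteq> t\<rbrakk> \<Longrightarrow> principal_right_ideal P s \<inter> principal_right_ideal P t = {}"
    using P.accurate_subset[OF inc finR] by blast
  have "\<exists>t\<in>R'. principal_right_ideal P p \<inter> principal_right_ideal P t \<noteq> {}" if p: "p \<in> carrier P" for p
  proof -
    obtain r x where r: "r \<in> R" "x \<in> principal_right_ideal P p" "x \<in> principal_right_ideal P r"
      using R(1) p unfolding foundation_set_def by blast
    obtain t where t: "t \<in> R'" "r \<in> principal_right_ideal P t"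
      using R'(2) r(1) by blast
    then have "t \<in> carrier P"
      using R'(1) finR(2) by blast
    then have "x \<in> principal_right_ideal P t"
      using P.principal_right_ideal_trans t(2) r(3) by blast
    then show ?thesis
      using r(2) t(1) by blast
  qed
  then have "accurate_foundation_set P R'"
    using R'(1,3) finR finite_subset[of R' R]
    unfolding accurate_foundation_set_def foundation_set_def by auto
  moreover have "\<forall>r'\<in>R'. \<exists>r\<in>R. r' \<in> principal_right_ideal P r"
    using R'(1) finR(2) P.principal_right_ideal_self by blast
  ultimately show "\<exists>R'. accurate_foundation_set P R' \<and> R' \<subseteq> finite_index_elements \<and>
      (\<forall>r'\<in>R'. \<exists>r\<in>R. r' \<in> principal_right_ideal P r)"
    using R'(1) R(2) by blast
qed


section \<open>Directed monoids and monoids of words\<close>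

lemma (in group) group_directed: "directed_monoid G"
proof -
  have "q \<in> principal_right_ideal G p" if "p \<in> carrier G" "q \<in> carrier G" for p q
    unfolding mem_principal_right_ideal_iff
    using that by (intro bexI[of _ "inv p \<otimes> q"]) (simp_all add: m_assoc[symmetric])
  then show ?thesis
    unfolding directed_monoid_def by blast
qed

lemma (in comm_monoid) comm_directed: "directed_monoid G"
proof -
  have "p \<otimes> q \<in> principal_right_ideal G p \<inter> principal_right_ideal G q"
    if "p \<in> carrier G" "q \<in> carrier G" for p q
    unfolding Int_iff mem_principal_right_ideal_iff using that m_comm by blast
  then show ?thesis
    unfolding directed_monoid_def by blast
qed

text \<open>Two prefixes of one word are comparable, so elements with a common multiple are
  comparable.\<close>

lemma incomparable_disjoint_prefixI:
  assumes "\<And>p q. \<lbrakk>p \<in> carrier P; q \<in> carrier P\<rbrakk> \<Longrightarrow>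
    q \<in> principal_right_ideal P p \<longleftrightarrow> prefix (f p) (f q)"
    and "\<And>p q. \<lbrakk>p \<in> carrier P; q \<in> carrier P\<rbrakk> \<Longrightarrow> p \<otimes>\<^bsub>P\<^esub> q \<in> carrier P"
  shows "incomparable_disjoint P"
proof -
  have "comparable P p q"
    if "p \<in> carrier P" "q \<in> carrier P" "x \<in> principal_right_ideal P p" "x \<in> principal_right_ideal P q"
    for p q x
  proof -
    have "x \<in> carrier P"
      using assms(2) that(1,3) unfolding mem_principal_right_ideal_iff by blast
    then have "prefix (f p) (f x)" "prefix (f q) (f x)"
      using assms(1) that by blast+
    then have "prefix (f p) (f q) \<or> prefix (f q) (f p)"
      using prefix_same_cases by blast
    then show ?thesis
      using assms(1) that unfolding comparable_def rdiv_le_def by blast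
  qed
  then show ?thesis
    unfolding incomparable_disjoint_def by blast
qed

lemma principal_right_ideal_iso:
  assumes f: "f \<in> iso P M" and pq: "p \<in> carrier P" "q \<in> carrier P" "\<And>x. x \<in> carrier P \<Longrightarrow> p \<otimes>\<^bsub>P\<^esub> x \<in> carrier P"
  shows "q \<in> principal_right_ideal P p \<longleftrightarrow> f q \<in> principal_right_ideal M (f p)"
proof -
  have hom: "f (p \<otimes>\<^bsub>P\<^esub> x) = f p \<otimes>\<^bsub>M\<^esub> f x" if "x \<in> carrier P" for x
    using f pq(1) that by (simp add: iso_def hom_def)
  have inj: "inj_on f (carrier P)" and surj: "f ` carrier P = carrier M"
    using f by (simp_all add: iso_def bij_betw_def)
  \<comment> \<open>Surjectivity of \<open>f\<close> lets the cofactor in \<open>M\<close> range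
    over images of elements of \<open>P\<close>; injectivity then removes \<open>f\<close> from the
    equation.\<close>
  have "f q \<in> principal_right_ideal M (f p) \<longleftrightarrow> (\<exists>x\<in>carrier P. f q = f (p \<otimes>\<^bsub>P\<^esub> x))"
    unfolding mem_principal_right_ideal_iff using hom bex_simps(7)[of f "carrier P"] surj by auto
  also have "\<dots> \<longleftrightarrow> (\<exists>x\<in>carrier P. q = p \<otimes>\<^bsub>P\<^esub> x)"
    using inj_onD[OF inj] pq(2,3) by blast
  finally show ?thesis
    by (simp add: mem_principal_right_ideal_iff)
qed

lemma (in monoid) incomparable_disjoint_iso:
  assumes iso: "G \<cong> M" and M: "\<And>p q. \<lbrakk>p \<in> carrier M; q \<in> carrier M\<rbrakk> \<Longrightarrow>
    q \<in> principal_right_ideal M p \<longleftrightarrow> prefix (w p) (w q)"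
  shows "incomparable_disjoint G"
proof -
  obtain f where f: "f \<in> iso G M"
    using iso by (auto simp: is_iso_def)
  then have "f p \<in> carrier M" if "p \<in> carrier G" for p
    using that by (auto simp: iso_def hom_def)
  then have "q \<in> principal_right_ideal G p \<longleftrightarrow> prefix ((w \<circ> f) p) ((w \<circ> f) q)"
    if "p \<in> carrier G" "q \<in> carrier G" for p q
    using that principal_right_ideal_iso[OF f that] M by simp
  then show ?thesis
    by (rule incomparable_disjoint_prefixI) auto
qed

lemma principal_right_ideal_free_monoid:
  assumes "q \<in> carrier (free_monoid A)"
  shows "q \<in> principal_right_ideal (free_monoid A) p \<longleftrightarrow> prefix p q"
  using assms unfolding mem_principal_right_ideal_iff prefix_def by (auto simp: free_monoid_def)

lemma (in self_similar_action) restr_word_closed: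
  "\<lbrakk>h \<in> carrier H; w \<in> lists A\<rbrakk> \<Longrightarrow> restr_word H A \<phi> h w \<in> carrier H"
proof (induction w arbitrary: h)
  case (Cons x w)
  have "h \<in> carrier H" "x \<in> A"
    using Cons.prems by auto
  then have "restr H A \<phi> h x \<in> carrier H"
    unfolding restr_def by (rule theI'[OF self_similar, THEN conjunct1])
  then show ?case using Cons by simp
qed simp

text \<open>The group coordinate imposes no condition because equations in \<open>H\<close> can be
  solved, and \<open>\<phi> h\<close> permutes the words, so divisibility depends on the word
  coordinates only.\<close>

lemma (in self_similar_action) principal_right_ideal_zappa_szep_product:
  assumes "p \<in> carrier (zappa_szep_product H A \<phi>)" "q \<in> carrier (zappa_szep_product H A \<phi>)"
  shows "q \<in> principal_right_ideal (zappa_szep_product H A \<phi>) p \<longleftrightarrow> prefix (fst p) (fst q)"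
proof -
  interpret H: group H
    using group_hom by (simp add: group_hom_def)
  obtain v h u k where pq: "p = (v, h)" "q = (u, k)"
    by (metis surj_pair)
  have h: "h \<in> carrier H" and u: "u \<in> lists A" and k: "k \<in> carrier H"
    using assms by (simp_all add: pq zappa_szep_product_def)
  have "q \<in> principal_right_ideal (zappa_szep_product H A \<phi>) p \<longleftrightarrow>
      (\<exists>w\<in>lists A. \<exists>l\<in>carrier H. u = v @ \<phi> h w \<and> k = restr_word H A \<phi> h w \<otimes>\<^bsub>H\<^esub> l)"
    unfolding mem_principal_right_ideal_iff by (auto simp: pq zappa_szep_product_def)
  also have "\<dots> \<longleftrightarrow> (\<exists>w\<in>lists A. u = v @ \<phi> h w)"
  proof -
    have "\<exists>l\<in>carrier H. k = restr_word H A \<phi> h w \<otimes>\<^bsub>H\<^esub> l" if w: "w \<in> lists A" for w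
    proof -
      have r: "restr_word H A \<phi> h w \<in> carrier H"
        using restr_word_closed[OF h w] .
      then show ?thesis
        using k by (intro bexI[of _ "inv\<^bsub>H\<^esub> restr_word H A \<phi> h w \<otimes>\<^bsub>H\<^esub> k"])
          (simp_all add: H.m_assoc[symmetric])
    qed
    then show ?thesis by blast
  qed
  also have "\<dots> \<longleftrightarrow> (\<exists>w\<in>lists A. u = v @ w)"
    \<comment> \<open>Since \<open>\<phi> h\<close> is onto \<open>lists A\<close>, the suffix
      \<open>\<phi> h w\<close> is an arbitrary word.\<close>
    using surj_prop[OF h] by (metis (no_types, lifting) image_iff)
  also have "\<dots> \<longleftrightarrow> prefix v u"
    using u by (auto simp: prefix_def)
  finally show ?thesis by (simp add: pq)
qed

text \<open>Groups and commutative monoids are directed; in free monoids and Zappa-Szep products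
  divisibility is a prefix relation, so incomparable elements have disjoint ideals.\<close>

theorem corollary3p11:
  fixes G :: "('g, 'm) monoid_scheme"
    and P :: "('p, 'n) monoid_scheme"
    and \<theta> :: "'p \<Rightarrow> 'g \<Rightarrow> 'g"
  assumes "algebraic_dynamical_system G P \<theta>"
  shows "(directed_monoid P \<or> incomparable_disjoint P \<longrightarrow>
            accurate_refinement_property (semidirect_product G P \<theta>)) \<and>
         (group P \<or>
          comm_monoid P \<or>
          (\<exists>n::nat. 1 \<le> n \<and> P \<cong> free_monoid {..<n}) \<or>
          (\<exists>(H :: 'h monoid) (A :: 'x set) \<phi>.
             self_similar_action H A \<phi> \<and> P \<cong> zappa_szep_product H A \<phi>) \<longrightarrow>
            accurate_refinement_property (semidirect_product G P \<theta>))"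
proof -
  interpret algebraic_dynamical_system G P \<theta> by fact
  have free: "incomparable_disjoint P" if "P \<cong> free_monoid {..<n}" for n :: nat
    using P.incomparable_disjoint_iso[OF that, of id] principal_right_ideal_free_monoid by auto
  have zappa_szep: "incomparable_disjoint P"
    if "self_similar_action H A \<phi>" "P \<cong> zappa_szep_product H A \<phi>"
    for H :: "'h monoid" and A :: "'x set" and \<phi>
    using P.incomparable_disjoint_iso[OF that(2), of fst]
      self_similar_action.principal_right_ideal_zappa_szep_product[OF that(1)] by auto
  show ?thesis
    using accurate_refinement_directed accurate_refinement_incomparable_disjoint
      group.group_directed[of P] comm_monoid.comm_directed[of P] free zappa_szep by blast
qed

end
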